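(* Let $\mathcal{E}$ be a Hilbert $K(\mathcal{H})$-module and let $T, S \in \mathcal{L}(\mathcal{E})$. Then the following statements are equivalent: (i) $T \| S$; (ii) there exist a sequence $\{x_n\}$ of basic vectors in $\mathcal{E}$, with $\langle x_n,x_n\rangle=\xi_n\otimes\xi_n$ for unit vectors $\xi_n\in\mathcal{H}$ ($n\in\mathbb{N}$), and some $\lambda\in\mathbb{T}$ such that $$\lim_n [\langle Tx_n , Sx_n \rangle \xi_n , \xi_n ] = \lambda\| T\| \| S\|.$$
   Context: $(\mathcal{H}, [\cdot,\cdot])$ is a complex Hilbert space and $K(\mathcal{H})$ is the $C^*$-algebra of compact linear operators on $\mathcal{H}$. A (left) Hilbert $\mathcal{A}$-module over a $C^*$-algebra $\mathcal{A}$ is a left $\mathcal{A}$-module with an $\mathcal{A}$-valued inner product $\langle\cdot,\cdot\rangle$, linear in the first variable and conjugate linear in the second, such that $\langle tx,y\rangle=t\langle x,y\rangle$ for $t\in\mathcal{A}$, $\langle x,y\rangle^*=\langle y,x\rangle$, $\langle x,x\rangle\ge 0$ with equality iff $x=0$, and which is complete for the norm $\|x\|=\|\langle x,x\rangle\|^{1/2}$. $\mathcal{L}(\mathcal{E})$ is the set of adjointable maps $T:\mathcal{E}\to\mathcal{E}$ (there is $T^*$ with $\langle Tx,y\rangle=\langle x,T^*y\rangle$ for all $x,y$), with the operator norm. For $\xi,\eta\in\mathcal{H}$, $\xi\otimes\eta$ is the operator $\nu\mapsto[\nu,\eta]\xi$. A projection $e\in K(\mathcal{H})$ is minimal if $eB(\mathcal{H})e=\mathbb{C}e$,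 equivalently $e=\xi\otimes\xi$ for a unit vector $\xi\in\mathcal{H}$. A vector $x\in\mathcal{E}$ is basic if $\langle x,x\rangle$ is a minimal projection. Norm-parallelism: for elements $x,y$ of a complex normed space, $x\|y$ means $\|x+\lambda y\|=\|x\|+\|y\|$ for some $\lambda\in\mathbb{T}=\{\alpha\in\mathbb{C}:|\alpha|=1\}$.
   Formalization: The Hilbert K(H)-module E is assumed to be nonzero; for E = {0} the operators T = S = 0 are parallel but there are no basic vectors, so (i) holds and (ii) fails. *)

theory Defs
  imports "HOL-Analysis.Analysis"
begin

section \<open>Complex normed spaces and complex Hilbert spaces\<close>

class complex_normed_vector = real_normed_vector +
  fixes scaleC :: "complex \<Rightarrow> 'a \<Rightarrow> 'a" (infixr "*\<^sub>C" 75)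
  assumes scaleC_add_right: "c *\<^sub>C (x + y) = c *\<^sub>C x + c *\<^sub>C y"
    and scaleC_add_left: "(c + d) *\<^sub>C x = c *\<^sub>C x + d *\<^sub>C x"
    and scaleC_scaleC: "c *\<^sub>C d *\<^sub>C x = (c * d) *\<^sub>C x"
    and scaleC_one: "1 *\<^sub>C x = x"
    and scaleR_scaleC: "r *\<^sub>R x = complex_of_real r *\<^sub>C x"
    and norm_scaleC: "norm (c *\<^sub>C x) = cmod c * norm x"

class complex_banach = complex_normed_vector + banach

text \<open>The inner product is linear in the first variable; positive definiteness is contained in
  the last axiom.\<close>

class complex_hilbert = complex_banach +
  fixes cinner :: "'a \<Rightarrow> 'a \<Rightarrow> complex"
  assumes cinner_add_left: "cinner (x + y) z = cinner x z + cinner y z"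
    and cinner_scaleC_left: "cinner (c *\<^sub>C x) y = c * cinner x y"
    and cinner_commute: "cinner y x = cnj (cinner x y)"
    and cinner_self: "cinner x x = complex_of_real ((norm x)\<^sup>2)"

instantiation complex :: complex_hilbert
begin

definition scaleC_complex :: "complex \<Rightarrow> complex \<Rightarrow> complex"
  where "scaleC_complex c x = c * x"

definition cinner_complex :: "complex \<Rightarrow> complex \<Rightarrow> complex"
  where "cinner_complex x y = x * cnj y"

instance
proof
  fix x :: complex
  show "cinner x x = complex_of_real ((norm x)\<^sup>2)"
    unfolding cinner_complex_def by (metis complex_norm_square of_real_power)
qed (simp_all add: scaleC_complex_def cinner_complex_def algebra_simps scaleR_conv_of_real norm_mult)

end

section \<open>Operators on a Hilbert space\<close>

text \<open>Operators are plain functions with pointwise linear structure; multiplication is composition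
  and the norm is \<^const>\<open>onorm\<close>.\<close>

definition bounded_ops :: "('h::complex_hilbert \<Rightarrow> 'h) set"
  where "bounded_ops = {t. bounded_linear t \<and> (\<forall>c \<xi>. t (c *\<^sub>C \<xi>) = c *\<^sub>C t \<xi>)}"

definition compact_ops :: "('h::complex_hilbert \<Rightarrow> 'h) set"
  where "compact_ops = {t \<in> bounded_ops. compact (closure (t ` cball 0 1))}"

definition is_op_adjoint :: "('h::complex_hilbert \<Rightarrow> 'h) \<Rightarrow> ('h \<Rightarrow> 'h) \<Rightarrow> bool"
  where "is_op_adjoint s t \<longleftrightarrow> (\<forall>\<xi> \<eta>. cinner (t \<xi>) \<eta> = cinner \<xi> (s \<eta>))"

definition positive_op :: "('h::complex_hilbert \<Rightarrow> 'h) \<Rightarrow> bool"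
  where "positive_op t \<longleftrightarrow> (\<forall>\<xi>. cinner (t \<xi>) \<xi> \<in> \<real> \<and> 0 \<le> Re (cinner (t \<xi>) \<xi>))"

definition rank_one :: "'h::complex_hilbert \<Rightarrow> 'h \<Rightarrow> 'h \<Rightarrow> 'h" (infix "\<otimes>\<^sub>H" 70)
  where "\<xi> \<otimes>\<^sub>H \<eta> = (\<lambda>\<nu>. cinner \<nu> \<eta> *\<^sub>C \<xi>)"

text \<open>The zero projection also satisfies \<open>e B(H) e = \<complex> e\<close> and has to be excluded in order that
  the minimal projections are exactly the \<open>\<xi> \<otimes> \<xi>\<close> with \<open>\<xi>\<close> a unit vector.\<close>

definition minimal_projection :: "('h::complex_hilbert \<Rightarrow> 'h) \<Rightarrow> bool"
  where "minimal_projection e \<longleftrightarrow>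
    e \<in> compact_ops \<and> e \<circ> e = e \<and> is_op_adjoint e e \<and> e \<noteq> (\<lambda>_. 0) \<and>
    {e \<circ> b \<circ> e |b. b \<in> bounded_ops} = {(\<lambda>\<xi>. c *\<^sub>C e \<xi>) |c. True}"

section \<open>Hilbert modules over the compact operators\<close>

text \<open>\<open>act\<close> is the left action of the compact operators and \<open>ip\<close> the operator-valued inner product;
  the values of \<open>act\<close> at non-compact operators are irrelevant. The class of \<open>'e\<close> supplies
  completeness for its norm, which the last axiom identifies with the norm induced by \<open>ip\<close>.\<close>

locale hilbert_compacts_module =
  fixes act :: "('h::complex_hilbert \<Rightarrow> 'h) \<Rightarrow> 'e::complex_banach \<Rightarrow> 'e"
    and ip :: "'e \<Rightarrow> 'e \<Rightarrow> 'h \<Rightarrow> 'h"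
  assumes act_add_right: "t \<in> compact_ops \<Longrightarrow> act t (x + y) = act t x + act t y"
    and act_add_left: "s \<in> compact_ops \<Longrightarrow> t \<in> compact_ops \<Longrightarrow>
      act (\<lambda>\<xi>. s \<xi> + t \<xi>) x = act s x + act t x"
    and act_comp: "s \<in> compact_ops \<Longrightarrow> t \<in> compact_ops \<Longrightarrow> act (s \<circ> t) x = act s (act t x)"
    and act_scaleC_left: "t \<in> compact_ops \<Longrightarrow> act (\<lambda>\<xi>. c *\<^sub>C t \<xi>) x = c *\<^sub>C act t x"
    and act_scaleC_right: "t \<in> compact_ops \<Longrightarrow> act t (c *\<^sub>C x) = c *\<^sub>C act t x"
    and ip_compact: "ip x y \<in> compact_ops"
    and ip_add_left: "ip (x + y) z = (\<lambda>\<xi>. ip x z \<xi> + ip y z \<xi>)"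
    and ip_scaleC_left: "ip (c *\<^sub>C x) y = (\<lambda>\<xi>. c *\<^sub>C ip x y \<xi>)"
    and ip_add_right: "ip x (y + z) = (\<lambda>\<xi>. ip x y \<xi> + ip x z \<xi>)"
    and ip_scaleC_right: "ip x (c *\<^sub>C y) = (\<lambda>\<xi>. cnj c *\<^sub>C ip x y \<xi>)"
    and ip_act_left: "t \<in> compact_ops \<Longrightarrow> ip (act t x) y = t \<circ> ip x y"
    and ip_adjoint: "is_op_adjoint (ip y x) (ip x y)"
    and ip_positive: "positive_op (ip x x)"
    and ip_eq_zero_iff: "ip x x = (\<lambda>_. 0) \<longleftrightarrow> x = 0"
    and norm_eq_sqrt_ip: "norm x = sqrt (onorm (ip x x))"

text \<open>No linearity or boundedness is demanded of an adjointable map: both are consequences.\<close>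

definition adjointable :: "('e \<Rightarrow> 'e \<Rightarrow> 'h \<Rightarrow> 'h) \<Rightarrow> ('e \<Rightarrow> 'e) \<Rightarrow> bool"
  where "adjointable ip T \<longleftrightarrow> (\<exists>T'. \<forall>x y. ip (T x) y = ip x (T' y))"

definition basic_vector :: "('e \<Rightarrow> 'e \<Rightarrow> 'h::complex_hilbert \<Rightarrow> 'h) \<Rightarrow> 'e \<Rightarrow> bool"
  where "basic_vector ip x \<longleftrightarrow> minimal_projection (ip x x)"

text \<open>Norm-parallelism in the space of adjointable maps with pointwise operations and operator
  norm.\<close>

definition op_parallel :: "('e::complex_normed_vector \<Rightarrow> 'e) \<Rightarrow> ('e \<Rightarrow> 'e) \<Rightarrow> bool"
    (infix "\<parallel>\<^sub>o\<^sub>p" 50)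
  where "T \<parallel>\<^sub>o\<^sub>p S \<longleftrightarrow>
    (\<exists>\<alpha>. cmod \<alpha> = 1 \<and> onorm (\<lambda>x. T x + \<alpha> *\<^sub>C S x) = onorm T + onorm S)"

end

theory Submission
  imports Defs
begin

text \<open>
  Each unit vector \<open>\<zeta>\<close> of the Hilbert space turns the module into a semi-inner product space with the
  scalar form \<open>vform \<zeta> x y = [\<langle>x, y\<rangle>\<zeta>, \<zeta>]\<close>, and \<open>\<parallel>x\<parallel>\<^sup>2\<close> is the supremum of \<open>vform \<zeta> x x\<close> over
  all unit \<open>\<zeta>\<close>, because a positive operator has the norm of its quadratic form.

  Basic vectors suffice to compute operator norms. For the projection \<open>e = \<zeta> \<otimes> \<zeta>\<close> one has
  \<open>\<langle>eu, eu\<rangle> = vform \<zeta> u u \<cdot> e\<close>, so \<open>eu\<close> is zero or a multiple of a basic vector. An adjointable map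
  \<open>R\<close> commutes with \<open>e\<close>, and compression by \<open>e\<close> leaves \<open>vform \<zeta>\<close> unchanged. Hence
  \<open>vform \<zeta> (Ru) (Ru)\<close> is controlled by the value of \<open>R\<close> at a basic vector, and \<open>\<parallel>R\<parallel>\<^sup>2\<close> is the supremum
  of \<open>vform \<zeta> (Rx) (Rx)\<close> over the vectors with \<open>\<langle>x, x\<rangle> = \<zeta> \<otimes> \<zeta>\<close>
  (\<open>vform_basic_le\<close>, \<open>obtain_basic_near_onorm\<close>). For operator norms to be meaningful, adjointable maps
  must be bounded; this is where completeness enters, through the Baire category theorem.

  The equivalence is then a computation in a semi-inner product space. For unimodular \<open>\<alpha>\<close>,
  \<open>vform \<zeta> ((T + \<alpha>S)x) ((T + \<alpha>S)x)\<close> is the sum of \<open>vform \<zeta> (Tx) (Tx) \<le> \<parallel>T\<parallel>\<^sup>2\<close>,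
  \<open>vform \<zeta> (Sx) (Sx) \<le> \<parallel>S\<parallel>\<^sup>2\<close> and \<open>2 Re (cnj \<alpha> \<cdot> vform \<zeta> (Tx) (Sx)) \<le> 2 \<parallel>T\<parallel> \<parallel>S\<parallel>\<close>. It approaches
  \<open>(\<parallel>T\<parallel> + \<parallel>S\<parallel>)\<^sup>2\<close> along a sequence of basic vectors exactly if all three terms approach their bounds. If
  \<open>\<parallel>T\<parallel>\<close> and \<open>\<parallel>S\<parallel>\<close> are nonzero, Cauchy-Schwarz makes the first two terms follow the third.
\<close>

section \<open>Cauchy-Schwarz for semi-inner products\<close>

lemma scaleC_zero_left: "0 *\<^sub>C (x::'a::complex_normed_vector) = 0"
  using norm_scaleC[of 0 x] by simp

lemma scaleC_zero_right: "c *\<^sub>C (0::'a::complex_normed_vector) = 0"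
  using norm_scaleC[of c "0::'a"] by simp

lemma scaleC_minus_one: "(-1) *\<^sub>C (x::'a::complex_normed_vector) = - x"
  using scaleR_scaleC[of "-1" x] by simp

lemma scaleC_scaleR_commute: "c *\<^sub>C r *\<^sub>R (x::'a::complex_normed_vector) = r *\<^sub>R c *\<^sub>C x"
  by (simp add: scaleR_scaleC scaleC_scaleC mult.commute)

lemma bounded_linear_scaleC: "bounded_linear (\<lambda>x::'a::complex_normed_vector. c *\<^sub>C x)"
  by (rule bounded_linear_intro[where K = "cmod c"])
    (simp_all add: scaleC_add_right scaleC_scaleR_commute norm_scaleC mult.commute)

lemma bounded_linear_scaleC_left: "bounded_linear (\<lambda>c. c *\<^sub>C (x::'a::complex_normed_vector))"
proof (rule bounded_linear_intro[where K = "norm x"])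
  show "(r *\<^sub>R c) *\<^sub>C x = r *\<^sub>R c *\<^sub>C x" for r and c :: complex
    unfolding scaleR_conv_of_real by (simp add: scaleR_scaleC scaleC_scaleC)
qed (simp_all add: scaleC_add_left norm_scaleC)

text \<open>Definiteness is left out: the vector forms of a module are degenerate in general.\<close>

locale semi_inner_product =
  fixes B :: "'v::complex_normed_vector \<Rightarrow> 'v \<Rightarrow> complex"
  assumes add_left: "B (x + y) z = B x z + B y z"
    and scaleC_left: "B (c *\<^sub>C x) y = c * B x y"
    and commute: "B y x = cnj (B x y)"
    and nonneg: "0 \<le> Re (B x x)"
begin

lemma add_right: "B x (y + z) = B x y + B x z"
  by (metis add_left commute complex_cnj_add)

lemma scaleC_right: "B x (c *\<^sub>C y) = cnj c * B x y"
  by (metis scaleC_left commute complex_cnj_mult)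

lemma self_real: "B x x = complex_of_real (Re (B x x))"
  by (metis commute complex_eqI Re_complex_of_real Im_complex_of_real cnj.simps(2) neg_equal_zero)

lemma Re_self_add_scaleC:
  "Re (B (x + c *\<^sub>C y) (x + c *\<^sub>C y)) =
    Re (B x x) + (cmod c)\<^sup>2 * Re (B y y) + 2 * Re (cnj c * B x y)"
proof -
  have "B (x + c *\<^sub>C y) (x + c *\<^sub>C y) =
      B x x + cnj c * B x y + (c * cnj (B x y) + c * cnj c * B y y)"
    by (simp add: add_left add_right scaleC_left scaleC_right algebra_simps commute[of y x])
  moreover have "c * cnj (B x y) = cnj (cnj c * B x y)"
    by simp
  moreover have "c * cnj c * B y y = complex_of_real ((cmod c)\<^sup>2 * Re (B y y))"
    by (metis self_real complex_norm_square of_real_mult)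
  ultimately show ?thesis
    by (simp del: complex_cnj_mult)
qed

text \<open>The form at \<open>x + c y\<close> is nonnegative for \<open>c = - s B x y\<close> with \<open>s\<close> real. If \<open>B y y \<noteq> 0\<close>, the
  minimising \<open>s\<close> gives the inequality; if \<open>B y y = 0\<close>, letting \<open>s\<close> be large forces \<open>B x y = 0\<close>.\<close>

theorem cauchy_schwarz: "(cmod (B x y))\<^sup>2 \<le> Re (B x x) * Re (B y y)"
proof -
  define p r b where "p = Re (B x x)" and "r = Re (B y y)" and "b = (cmod (B x y))\<^sup>2"
  have quadratic: "0 \<le> p + s\<^sup>2 * b * r - 2 * s * b" for s :: real
  proof -
    define c where "c = - complex_of_real s * B x y"
    have "cnj c * B x y = - complex_of_real (s * b)"
      unfolding c_def b_def using complex_norm_square[of "B x y"]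
      by (simp add: algebra_simps)
    moreover have "(cmod c)\<^sup>2 = s\<^sup>2 * b"
      by (simp add: c_def b_def norm_mult power_mult_distrib)
    ultimately show ?thesis
      using nonneg[of "x + c *\<^sub>C y"] unfolding Re_self_add_scaleC
      by (simp add: p_def r_def)
  qed
  have "b \<le> p * r"
  proof (cases "r = 0")
    case True
    have "b = 0"
    proof (rule ccontr)
      assume "b \<noteq> 0"
      then show False
        using quadratic[of "(p + 1) / (2 * b)"] True nonneg[of x] by (simp add: p_def)
    qed
    then show ?thesis
      using True by simp
  next
    case False
    then have "0 < r"
      using nonneg[of y] by (simp add: r_def)
    then show ?thesis
      using quadratic[of "1 / r"] by (simp add: field_simps power2_eq_square)
  qed
  then show ?thesis
    by (simp add: p_def r_def b_def)
qed

end

section \<open>Positive operators and rank-one projections\<close>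

interpretation cinner: semi_inner_product "cinner :: 'h::complex_hilbert \<Rightarrow> 'h \<Rightarrow> complex"
  by unfold_locales (auto simp: cinner_add_left cinner_scaleC_left cinner_self intro: cinner_commute)

lemma Re_cinner_self: "Re (cinner \<xi> \<xi>) = (norm \<xi>)\<^sup>2"
  by (simp add: cinner_self)

lemma cmod_cinner_le: "cmod (cinner \<xi> \<eta>) \<le> norm \<xi> * norm \<eta>"
  using cinner.cauchy_schwarz[of \<xi> \<eta>]
  by (intro power2_le_imp_le[OF _ mult_nonneg_nonneg]) (simp_all add: Re_cinner_self power_mult_distrib)

lemma bounded_opsD:
  assumes "t \<in> bounded_ops"
  shows "bounded_linear t" and "t (c *\<^sub>C \<xi>) = c *\<^sub>C t \<xi>" and "t (\<xi> + \<eta>) = t \<xi> + t \<eta>"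
proof -
  show "bounded_linear t" and "t (c *\<^sub>C \<xi>) = c *\<^sub>C t \<xi>"
    using assms by (auto simp: bounded_ops_def)
  then show "t (\<xi> + \<eta>) = t \<xi> + t \<eta>"
    by (simp add: bounded_linear.linear linear_add)
qed

lemma compact_ops_bounded: "t \<in> compact_ops \<Longrightarrow> t \<in> bounded_ops"
  by (simp add: compact_ops_def)

text \<open>Cauchy-Schwarz for the form \<open>[t \<xi>, \<eta>]\<close>, taken at \<open>\<eta> = t \<xi>\<close>, bounds \<open>\<parallel>t \<xi>\<parallel>\<^sup>4\<close> by
  \<open>[t \<xi>, \<xi>] [t (t \<xi>), t \<xi>] \<le> M \<parallel>\<xi>\<parallel>\<^sup>2 \<cdot> M \<parallel>t \<xi>\<parallel>\<^sup>2\<close>.\<close>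

lemma onorm_positive_op_le:
  assumes t: "t \<in> bounded_ops" and pos: "positive_op t" and self: "is_op_adjoint t t"
    and M: "0 \<le> M" and form_le: "\<And>\<xi>. Re (cinner (t \<xi>) \<xi>) \<le> M * (norm \<xi>)\<^sup>2"
  shows "onorm t \<le> M"
proof (rule onorm_bound[OF M])
  fix \<xi>
  interpret form: semi_inner_product "\<lambda>\<xi> \<eta>. cinner (t \<xi>) \<eta>"
  proof
    fix x y z c
    show "cinner (t (x + y)) z = cinner (t x) z + cinner (t y) z"
      by (simp add: bounded_opsD[OF t] cinner_add_left)
    show "cinner (t (c *\<^sub>C x)) y = c * cinner (t x) y"
      by (simp add: bounded_opsD[OF t] cinner_scaleC_left)
    show "cinner (t y) x = cnj (cinner (t x) y)"
      using self by (metis is_op_adjoint_def cinner_commute)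
    show "0 \<le> Re (cinner (t x) x)"
      using pos by (simp add: positive_op_def)
  qed
  have "((norm (t \<xi>))\<^sup>2)\<^sup>2 \<le> Re (cinner (t \<xi>) \<xi>) * Re (cinner (t (t \<xi>)) (t \<xi>))"
    using form.cauchy_schwarz[of \<xi> "t \<xi>"] by (simp add: cinner_self norm_power)
  also have "\<dots> \<le> (M * (norm \<xi>)\<^sup>2) * (M * (norm (t \<xi>))\<^sup>2)"
    by (intro mult_mono form_le form.nonneg mult_nonneg_nonneg M zero_le_power2)
  finally have le: "(norm (t \<xi>))\<^sup>2 * (norm (t \<xi>))\<^sup>2 \<le> (M * norm \<xi>)\<^sup>2 * (norm (t \<xi>))\<^sup>2"
    by (simp add: power2_eq_square algebra_simps)
  have "(norm (t \<xi>))\<^sup>2 \<le> (M * norm \<xi>)\<^sup>2"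
  proof (cases "t \<xi> = 0")
    case False
    then show ?thesis
      by (intro mult_right_le_imp_le[OF le]) simp
  qed simp
  then show "norm (t \<xi>) \<le> M * norm \<xi>"
    by (rule power2_le_imp_le) (simp add: M)
qed

lemma rank_one_compact: "\<xi> \<otimes>\<^sub>H \<eta> \<in> compact_ops"
proof -
  have "bounded_linear (\<xi> \<otimes>\<^sub>H \<eta>)"
    unfolding rank_one_def
  proof (rule bounded_linear_intro[where K = "norm \<eta> * norm \<xi>"])
    fix \<nu> :: 'a
    show "norm (cinner \<nu> \<eta> *\<^sub>C \<xi>) \<le> norm \<nu> * (norm \<eta> * norm \<xi>)"
      using mult_right_mono[OF cmod_cinner_le[of \<nu> \<eta>], of "norm \<xi>"]
      by (simp add: norm_scaleC mult.assoc)
  qed (simp_all add: cinner_add_left scaleC_add_left scaleR_scaleC cinner_scaleC_left scaleC_scaleC)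
  then have bounded: "\<xi> \<otimes>\<^sub>H \<eta> \<in> bounded_ops"
    by (simp add: bounded_ops_def rank_one_def cinner_scaleC_left scaleC_scaleC)
  \<comment> \<open>The unit ball is mapped into a disc of the line spanned by \<open>\<xi>\<close>.\<close>
  let ?K = "(\<lambda>c. c *\<^sub>C \<xi>) ` cball 0 (norm \<eta>)"
  have "compact ?K"
    by (intro compact_continuous_image compact_cball
        linear_continuous_on[OF bounded_linear_scaleC_left])
  moreover have "(\<xi> \<otimes>\<^sub>H \<eta>) ` cball 0 1 \<subseteq> ?K"
  proof
    fix y assume "y \<in> (\<xi> \<otimes>\<^sub>H \<eta>) ` cball 0 1"
    then obtain \<nu> where "norm \<nu> \<le> 1" and y: "y = cinner \<nu> \<eta> *\<^sub>C \<xi>"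
      by (auto simp: rank_one_def)
    then have "cmod (cinner \<nu> \<eta>) \<le> norm \<eta>"
      using cmod_cinner_le[of \<nu> \<eta>] mult_right_mono[of "norm \<nu>" 1 "norm \<eta>"] by simp
    then show "y \<in> ?K"
      using y by auto
  qed
  ultimately have "compact (closure ((\<xi> \<otimes>\<^sub>H \<eta>) ` cball 0 1))"
    using compact_Int_closed[OF _ closed_closure] closure_minimal compact_imp_closed
    by (metis inf.absorb_iff2)
  with bounded show ?thesis
    by (simp add: compact_ops_def)
qed

lemma cinner_rank_one_self:
  "cinner ((\<zeta> \<otimes>\<^sub>H \<zeta>) \<xi>) \<eta> = cinner \<xi> ((\<zeta> \<otimes>\<^sub>H \<zeta>) \<eta>)"
  by (simp add: rank_one_def cinner_scaleC_left cinner.scaleC_right cinner_commute[of \<zeta> \<eta>])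

text \<open>This is the minimality of rank-one projections, and also the reason why compressing the module
  inner product leaves only the number \<open>[\<langle>x, y\<rangle>\<zeta>, \<zeta>]\<close>.\<close>

lemma rank_one_sandwich:
  assumes "b \<in> bounded_ops"
  shows "(\<zeta> \<otimes>\<^sub>H \<zeta>) (b ((\<zeta> \<otimes>\<^sub>H \<zeta>) \<nu>)) = cinner (b \<zeta>) \<zeta> *\<^sub>C (\<zeta> \<otimes>\<^sub>H \<zeta>) \<nu>"
  by (simp add: rank_one_def bounded_opsD[OF assms] cinner_scaleC_left scaleC_scaleC mult.commute)

lemma minimal_projection_rank_one:
  fixes \<zeta> :: "'h::complex_hilbert"
  assumes "norm \<zeta> = 1"
  shows "minimal_projection (\<zeta> \<otimes>\<^sub>H \<zeta>)"
proof -
  let ?e = "\<zeta> \<otimes>\<^sub>H \<zeta>"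
  have e_\<zeta>: "?e \<zeta> = \<zeta>"
    by (simp add: rank_one_def cinner_self assms scaleC_one)
  have idem: "?e (?e \<nu>) = ?e \<nu>" for \<nu>
    by (simp add: rank_one_def cinner_scaleC_left cinner_self assms)
  have "{?e \<circ> b \<circ> ?e |b. b \<in> bounded_ops} = {(\<lambda>\<xi>. c *\<^sub>C ?e \<xi>) |c. True}" (is "?L = ?R")
  proof (intro equalityI subsetI)
    fix f assume "f \<in> ?L"
    then obtain b where "b \<in> bounded_ops" "f = ?e \<circ> b \<circ> ?e"
      by blast
    then have "f = (\<lambda>\<xi>. cinner (b \<zeta>) \<zeta> *\<^sub>C ?e \<xi>)"
      by (simp add: fun_eq_iff rank_one_sandwich)
    then show "f \<in> ?R"
      by blast
  next
    fix f assume "f \<in> ?R"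
    then obtain c where f: "f = (\<lambda>\<xi>. c *\<^sub>C ?e \<xi>)"
      by blast
    have b: "(\<lambda>\<xi>::'h. c *\<^sub>C \<xi>) \<in> bounded_ops"
      by (simp add: bounded_ops_def bounded_linear_scaleC scaleC_scaleC mult.commute)
    have "f = ?e \<circ> (\<lambda>\<xi>. c *\<^sub>C \<xi>) \<circ> ?e"
      by (simp add: f fun_eq_iff rank_one_sandwich[OF b] cinner_scaleC_left cinner_self assms)
    with b show "f \<in> ?L"
      by blast
  qed
  moreover have "?e \<noteq> (\<lambda>_. 0)"
    using e_\<zeta> assms by (metis norm_zero zero_neq_one)
  ultimately show ?thesis
    using idem by (auto simp: minimal_projection_def rank_one_compact is_op_adjoint_def
        cinner_rank_one_self fun_eq_iff)
qed

section \<open>The vector forms of the module\<close>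

context hilbert_compacts_module
begin

definition vform :: "'h \<Rightarrow> 'e \<Rightarrow> 'e \<Rightarrow> complex"
  where "vform \<zeta> x y = cinner (ip x y \<zeta>) \<zeta>"

lemma ip_bounded: "ip x y \<in> bounded_ops"
  by (rule compact_ops_bounded[OF ip_compact])

lemma cinner_ip_swap: "cinner (ip x y \<xi>) \<eta> = cinner \<xi> (ip y x \<eta>)"
  using ip_adjoint by (auto simp: is_op_adjoint_def)

sublocale vform: semi_inner_product "vform \<zeta>" for \<zeta>
proof
  fix x y z :: 'e and c
  show "vform \<zeta> (x + y) z = vform \<zeta> x z + vform \<zeta> y z"
    by (simp add: vform_def ip_add_left cinner_add_left)
  show "vform \<zeta> (c *\<^sub>C x) y = c * vform \<zeta> x y"
    by (simp add: vform_def ip_scaleC_left cinner_scaleC_left)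
  show "vform \<zeta> y x = cnj (vform \<zeta> x y)"
    unfolding vform_def cinner_ip_swap[of y x] by (rule cinner_commute)
  show "0 \<le> Re (vform \<zeta> x x)"
    using ip_positive by (simp add: vform_def positive_op_def)
qed

lemma onorm_ip_self: "onorm (ip x x) = (norm x)\<^sup>2"
  using norm_eq_sqrt_ip[of x] onorm_pos_le[OF bounded_opsD(1)[OF ip_bounded], of x x] by simp

lemma vform_self_le: "Re (vform \<zeta> x x) \<le> (norm x)\<^sup>2 * (norm \<zeta>)\<^sup>2"
proof -
  have "Re (vform \<zeta> x x) \<le> norm (ip x x \<zeta>) * norm \<zeta>"
    unfolding vform_def using complex_Re_le_cmod cmod_cinner_le by (rule order_trans)
  also have "\<dots> \<le> (onorm (ip x x) * norm \<zeta>) * norm \<zeta>"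
    by (intro mult_right_mono onorm[OF bounded_opsD(1)[OF ip_bounded]] norm_ge_zero)
  finally show ?thesis
    by (simp add: onorm_ip_self power2_eq_square mult.assoc)
qed

text \<open>Together with \<open>vform_self_le\<close>: the square of the module norm is the supremum of the vector
  forms at unit vectors.\<close>

lemma norm_le_if_vform_le:
  assumes "0 \<le> M" and le: "\<And>\<zeta>. norm \<zeta> = 1 \<Longrightarrow> Re (vform \<zeta> x x) \<le> M"
  shows "(norm x)\<^sup>2 \<le> M"
proof -
  have "Re (cinner (ip x x \<xi>) \<xi>) \<le> M * (norm \<xi>)\<^sup>2" for \<xi>
  proof (cases "\<xi> = 0")
    case True
    then show ?thesis
      using cmod_cinner_le[of "ip x x \<xi>" \<xi>] by simp
  next
    case False
    define \<zeta> where "\<zeta> = complex_of_real (1 / norm \<xi>) *\<^sub>C \<xi>"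
    have "norm \<zeta> = 1"
      using False by (simp add: \<zeta>_def norm_scaleC norm_divide)
    then have "Re (vform \<zeta> x x) \<le> M"
      by (rule le)
    moreover have "vform \<zeta> x x = complex_of_real ((1 / norm \<xi>)\<^sup>2) * cinner (ip x x \<xi>) \<xi>"
      by (simp add: vform_def \<zeta>_def bounded_opsD[OF ip_bounded] cinner_scaleC_left
          cinner.scaleC_right power2_eq_square)
    ultimately show ?thesis
      using False by (simp add: field_simps del: of_real_power of_real_divide)
  qed
  then show ?thesis
    using onorm_positive_op_le[OF ip_bounded ip_positive ip_adjoint \<open>0 \<le> M\<close>]
    by (simp add: onorm_ip_self)
qed

lemma vform_continuous: "continuous_on UNIV (\<lambda>x. vform \<zeta> x y)"
proof (rule linear_continuous_on[OF bounded_linear_intro[where K = "norm y * (norm \<zeta>)\<^sup>2"]])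
  fix x :: 'e and r :: real
  show "vform \<zeta> (r *\<^sub>R x) y = r *\<^sub>R vform \<zeta> x y"
    by (simp add: scaleR_scaleC vform.scaleC_left scaleC_complex_def)
  have "(cmod (vform \<zeta> x y))\<^sup>2 \<le> ((norm x)\<^sup>2 * (norm \<zeta>)\<^sup>2) * ((norm y)\<^sup>2 * (norm \<zeta>)\<^sup>2)"
    by (rule order_trans[OF vform.cauchy_schwarz])
      (intro mult_mono vform_self_le vform.nonneg mult_nonneg_nonneg zero_le_power2)
  also have "\<dots> = (norm x * (norm y * (norm \<zeta>)\<^sup>2))\<^sup>2"
    by (simp add: power2_eq_square algebra_simps)
  finally show "norm (vform \<zeta> x y) \<le> norm x * (norm y * (norm \<zeta>)\<^sup>2)"
    by (rule power2_le_imp_le) simp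
qed (rule vform.add_left)

lemma ip_act_right:
  assumes "\<And>\<xi> \<eta>. cinner (t \<xi>) \<eta> = cinner \<xi> (t \<eta>)" and t: "t \<in> compact_ops"
  shows "ip x (act t y) \<nu> = ip x y (t \<nu>)"
proof -
  have "cinner (ip x (act t y) \<nu>) \<eta> = cinner (ip x y (t \<nu>)) \<eta>" for \<eta>
    by (simp add: cinner_ip_swap[of x] ip_act_left[OF t] assms(1))
  then have "cinner (ip x (act t y) \<nu> + (-1) *\<^sub>C ip x y (t \<nu>)) \<eta> = 0" for \<eta>
    by (simp add: cinner_add_left cinner_scaleC_left)
  from this[of "ip x (act t y) \<nu> + (-1) *\<^sub>C ip x y (t \<nu>)"] show ?thesis
    by (simp add: cinner_self scaleC_minus_one)
qed

text \<open>A compressed vector has inner square a multiple of a minimal projection, and by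
  \<open>vform_compress\<close> the form at \<open>\<zeta>\<close> does not notice the compression.\<close>

lemma ip_compress:
  "ip (act (\<zeta> \<otimes>\<^sub>H \<zeta>) x) (act (\<zeta> \<otimes>\<^sub>H \<zeta>) y) = (\<lambda>\<nu>. vform \<zeta> x y *\<^sub>C (\<zeta> \<otimes>\<^sub>H \<zeta>) \<nu>)"
  by (simp add: fun_eq_iff ip_act_left rank_one_compact ip_act_right cinner_rank_one_self
      rank_one_sandwich[OF ip_bounded] vform_def)

lemma vform_compress:
  assumes "norm \<zeta> = 1"
  shows "vform \<zeta> (act (\<zeta> \<otimes>\<^sub>H \<zeta>) x) (act (\<zeta> \<otimes>\<^sub>H \<zeta>) y) = vform \<zeta> x y"
  unfolding vform_def[of \<zeta> "act _ _"] ip_compress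
  by (simp add: rank_one_def cinner_scaleC_left cinner_self assms)

section \<open>Adjointable maps\<close>

lemma eq_if_ip_eq:
  assumes "\<And>y. ip a y = ip b y"
  shows "a = b"
proof -
  have "ip (a + (-1) *\<^sub>C b) y = (\<lambda>_. 0)" for y
    unfolding ip_add_left ip_scaleC_left assms unfolding scaleC_minus_one by simp
  then show ?thesis
    using ip_eq_zero_iff[of "a + (-1) *\<^sub>C b"] by (simp add: scaleC_minus_one)
qed

lemma adjointable_add_scaleC:
  assumes "adjointable ip T" "adjointable ip S"
  shows "adjointable ip (\<lambda>x. T x + c *\<^sub>C S x)"
proof -
  obtain T' S' where "\<And>x y. ip (T x) y = ip x (T' y)" "\<And>x y. ip (S x) y = ip x (S' y)"
    using assms by (auto simp: adjointable_def)
  then have "ip (T x + c *\<^sub>C S x) y = ip x (T' y + cnj c *\<^sub>C S' y)" for x y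
    by (simp add: ip_add_left ip_scaleC_left ip_add_right ip_scaleC_right)
  then show ?thesis
    by (auto simp: adjointable_def)
qed

lemma adjointable_linear:
  assumes "adjointable ip T"
  shows "T (x + y) = T x + T y" and "T (c *\<^sub>C x) = c *\<^sub>C T x"
    and "t \<in> compact_ops \<Longrightarrow> T (act t x) = act t (T x)"
proof -
  obtain T' where T': "\<And>x y. ip (T x) y = ip x (T' y)"
    using assms by (auto simp: adjointable_def)
  show "T (x + y) = T x + T y" and "T (c *\<^sub>C x) = c *\<^sub>C T x"
    by (rule eq_if_ip_eq; simp add: T' ip_add_left ip_scaleC_left)+
  show "T (act t x) = act t (T x)" if "t \<in> compact_ops"
    by (rule eq_if_ip_eq) (simp add: T' ip_act_left that)
qed

text \<open>The sets \<open>F n = {x. \<parallel>T x\<parallel> \<le> n}\<close> cover the module. They are closed although \<open>T\<close> is not yet known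
  to be continuous: by Cauchy-Schwarz, \<open>F n\<close> is cut out by conditions on \<open>[\<langle>T x, y\<rangle>\<zeta>, \<zeta>]\<close>, and moving
  \<open>T\<close> to the other side makes these continuous in \<open>x\<close>. By Baire some \<open>F n\<close> contains a ball, which bounds
  the linear map \<open>T\<close>.\<close>

theorem adjointable_bounded_linear:
  assumes T: "adjointable ip T"
  shows "bounded_linear T"
proof -
  obtain T' where T': "\<And>x y. ip (T x) y = ip x (T' y)"
    using assms by (auto simp: adjointable_def)
  then have vform_eq: "vform \<zeta> (T x) y = vform \<zeta> x (T' y)" for \<zeta> x y
    by (simp add: vform_def)
  have linear: "linear T"
    by (rule linearI) (simp_all add: adjointable_linear[OF T] scaleR_scaleC)
  define F where "F n = {x. norm (T x) \<le> real n}" for n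
  have closed_F: "closed (F n)" for n
  proof -
    have "F n = {x. \<forall>\<zeta>. norm \<zeta> = 1 \<longrightarrow> (\<forall>y. (cmod (vform \<zeta> x (T' y)))\<^sup>2 \<le> (real n)\<^sup>2 * Re (vform \<zeta> y y))}"
      (is "_ = ?G")
    proof (intro equalityI subsetI CollectI allI impI)
      fix x y and \<zeta> :: 'h assume "x \<in> F n" and "norm \<zeta> = 1"
      then have "Re (vform \<zeta> (T x) (T x)) \<le> (norm (T x))\<^sup>2" and "(norm (T x))\<^sup>2 \<le> (real n)\<^sup>2"
        using vform_self_le[of \<zeta> "T x"] by (auto simp: F_def intro!: power_mono)
      then have "Re (vform \<zeta> (T x) (T x)) \<le> (real n)\<^sup>2"
        by (rule order_trans)
      then have "(cmod (vform \<zeta> (T x) y))\<^sup>2 \<le> (real n)\<^sup>2 * Re (vform \<zeta> y y)"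
        by (intro order_trans[OF vform.cauchy_schwarz] mult_right_mono vform.nonneg)
      then show "(cmod (vform \<zeta> x (T' y)))\<^sup>2 \<le> (real n)\<^sup>2 * Re (vform \<zeta> y y)"
        by (simp add: vform_eq)
    next
      fix x assume x: "x \<in> ?G"
      have "Re (vform \<zeta> (T x) (T x)) \<le> (real n)\<^sup>2" if "norm \<zeta> = 1" for \<zeta>
      proof -
        \<comment> \<open>The condition at \<open>y = T x\<close> reads \<open>v\<^sup>2 \<le> n\<^sup>2 v\<close>.\<close>
        define v where "v = Re (vform \<zeta> (T x) (T x))"
        have "(cmod (vform \<zeta> x (T' (T x))))\<^sup>2 \<le> (real n)\<^sup>2 * v"
          unfolding v_def using x that by blast
        then have "(cmod (vform \<zeta> (T x) (T x)))\<^sup>2 \<le> (real n)\<^sup>2 * v"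
          by (simp only: vform_eq)
        moreover have "vform \<zeta> (T x) (T x) = complex_of_real v"
          unfolding v_def by (rule vform.self_real)
        ultimately have "v * v \<le> (real n)\<^sup>2 * v"
          by (simp add: power2_eq_square)
        moreover have "0 \<le> v"
          unfolding v_def by (rule vform.nonneg)
        ultimately show ?thesis
          unfolding v_def[symmetric] by (cases "v = 0") auto
      qed
      then have "(norm (T x))\<^sup>2 \<le> (real n)\<^sup>2"
        by (intro norm_le_if_vform_le) auto
      then show "x \<in> F n"
        by (auto simp: F_def intro: power2_le_imp_le)
    qed
    also have "closed \<dots>"
      by (intro closed_Collect_all closed_Collect_imp open_Collect_const closed_Collect_le continuous_intros
          vform_continuous)
    finally show ?thesis .
  qed
  have "x \<in> \<Union>(range F)" for x
    using real_nat_ceiling_ge[of "norm (T x)"] unfolding F_def by blast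
  then have "\<Union>(range F) = UNIV"
    by blast
  moreover have "interior (\<Union>(range F)) = {}" if "\<forall>n. interior (F n) = {}"
  proof -
    have "euclidean interior_of \<Union>(range F) = {}"
      using closed_F that
      by (intro Baire_category_alt disjI1[OF completely_metrizable_space_euclidean]) auto
    then show ?thesis
      by simp
  qed
  ultimately have "\<not> (\<forall>n. interior (F n) = {})"
    by auto
  then obtain n x where "x \<in> interior (F n)"
    by blast
  then obtain \<epsilon> where \<epsilon>: "0 < \<epsilon>" and ball: "cball x \<epsilon> \<subseteq> F n"
    by (auto simp: mem_interior_cball)
  have bound: "norm (T y) \<le> norm y * (2 * real n / \<epsilon>)" for y
  proof (cases "y = 0")
    case True
    then show ?thesis
      using linear_0[OF linear] by simp
  next
    case False
    define z where "z = (\<epsilon> / norm y) *\<^sub>R y"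
    have "norm z = \<epsilon>"
      using False \<epsilon> by (simp add: z_def)
    then have "x + z \<in> F n" and "x \<in> F n"
      using ball \<epsilon> by (auto simp: dist_norm subset_iff)
    then have "norm (T (x + z) - T x) \<le> real n + real n"
      by (intro order_trans[OF norm_triangle_ineq4] add_mono) (auto simp: F_def)
    then have "norm (T z) \<le> 2 * real n"
      by (simp add: linear_add[OF linear])
    then show ?thesis
      using False \<epsilon> by (simp add: z_def linear_scale[OF linear] field_simps)
  qed
  show ?thesis
    by (rule bounded_linear_intro[OF _ _ bound]) (simp_all add: linear_add[OF linear] linear_scale[OF linear])
qed

section \<open>Basic vectors compute the norm\<close>

text \<open>Basic vectors are kept together with a unit vector that spans the range of their inner square,
  since the limit in the theorem evaluates the form at that vector.\<close>

definition basic_at :: "'h \<Rightarrow> 'e \<Rightarrow> bool"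
  where "basic_at \<zeta> x \<longleftrightarrow> norm \<zeta> = 1 \<and> ip x x = \<zeta> \<otimes>\<^sub>H \<zeta>"

lemma basic_at_basic_vector: "basic_at \<zeta> x \<Longrightarrow> basic_vector ip x"
  by (simp add: basic_at_def basic_vector_def minimal_projection_rank_one)

lemma norm_le_one_if_basic_at:
  assumes "basic_at \<zeta> x"
  shows "norm x \<le> 1"
proof -
  have "(norm x)\<^sup>2 \<le> 1"
  proof (rule norm_le_if_vform_le)
    fix \<xi> :: 'h assume "norm \<xi> = 1"
    have "Re (vform \<xi> x x) \<le> cmod (cinner \<xi> \<zeta>) * cmod (cinner \<zeta> \<xi>)"
      using assms complex_Re_le_cmod[of "vform \<xi> x x"]
      by (simp add: basic_at_def vform_def rank_one_def cinner_scaleC_left norm_mult)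
    also have "\<dots> \<le> 1 * 1"
      using cmod_cinner_le[of \<xi> \<zeta>] cmod_cinner_le[of \<zeta> \<xi>] assms \<open>norm \<xi> = 1\<close>
      by (intro mult_mono) (auto simp: basic_at_def)
    finally show "Re (vform \<xi> x x) \<le> 1"
      by simp
  qed simp
  then show ?thesis
    by (simp add: power_le_one_iff abs_square_le_1)
qed

lemma vform_basic_le:
  assumes "adjointable ip R" and "basic_at \<zeta> x"
  shows "Re (vform \<zeta> (R x) (R x)) \<le> (onorm R)\<^sup>2"
proof -
  have R: "bounded_linear R"
    by (rule adjointable_bounded_linear[OF assms(1)])
  have "norm (R x) \<le> onorm R * 1"
    by (rule order_trans[OF onorm[OF R]])
      (intro mult_left_mono norm_le_one_if_basic_at[OF assms(2)] onorm_pos_le[OF R])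
  then have "(norm (R x))\<^sup>2 \<le> (onorm R)\<^sup>2"
    by (intro power_mono) auto
  then show ?thesis
    using vform_self_le[of \<zeta> "R x"] assms(2) by (simp add: basic_at_def)
qed

text \<open>Suppose that \<open>vform \<zeta> (R x) (R x) \<le> M\<close> at all basic vectors. Compressing an arbitrary \<open>u\<close> by
  \<open>\<zeta> \<otimes> \<zeta>\<close> and normalising gives \<open>vform \<zeta> (R u) (R u) \<le> M \<cdot> vform \<zeta> u u\<close>, so that \<open>\<parallel>R\<parallel>\<^sup>2 \<le> M\<close>. Negative
  \<open>M\<close> are included, so the result provides basic vectors even for \<open>R = 0\<close>; there a nonzero vector in
  the module gives the contradiction.\<close>

theorem obtain_basic_near_onorm:
  assumes R: "adjointable ip R" and nonzero: "\<exists>x::'e. x \<noteq> 0" and M: "M < (onorm R)\<^sup>2"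
  obtains \<zeta> x where "basic_at \<zeta> x" and "M < Re (vform \<zeta> (R x) (R x))"
proof (rule ccontr)
  note witness = that
  assume "\<not> thesis"
  then have basic_le: "Re (vform \<zeta> (R x) (R x)) \<le> M" if "basic_at \<zeta> x" for \<zeta> x
    using witness[OF that] by force
  have form_le: "Re (vform \<zeta> (R u) (R u)) \<le> M * Re (vform \<zeta> u u)" if \<zeta>: "norm \<zeta> = 1" for \<zeta> u
  proof -
    define c where "c = Re (vform \<zeta> u u)"
    define y where "y = act (\<zeta> \<otimes>\<^sub>H \<zeta>) u"
    have ip_y: "ip y y = (\<lambda>\<nu>. complex_of_real c *\<^sub>C (\<zeta> \<otimes>\<^sub>H \<zeta>) \<nu>)"
      unfolding y_def ip_compress c_def using vform.self_real[of \<zeta> u] by metis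
    have R_y: "vform \<zeta> (R y) (R y) = vform \<zeta> (R u) (R u)"
      by (simp add: y_def adjointable_linear[OF R] rank_one_compact vform_compress[OF \<zeta>])
    show ?thesis
    proof (cases "c = 0")
      case True
      then have "y = 0"
        using ip_y ip_eq_zero_iff[of y] by (simp add: scaleC_zero_left)
      then have "R y = 0"
        by (simp add: linear_0 bounded_linear.linear[OF adjointable_bounded_linear[OF R]])
      then have "vform \<zeta> (R u) (R u) = 0"
        using R_y vform_self_le[of \<zeta> 0] vform.nonneg[of \<zeta> 0] vform.self_real[of \<zeta> 0] by simp
      then show ?thesis
        using True by (simp add: c_def)
    next
      case False
      then have "0 < c"
        using vform.nonneg[of \<zeta> u] by (simp add: c_def)
      define a where "a = complex_of_real (1 / sqrt c)"
      have a: "a * cnj a = complex_of_real (1 / c)"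
        using \<open>0 < c\<close> by (simp add: a_def flip: of_real_mult)
      have "cnj a * (a * complex_of_real c) = 1"
        using a \<open>0 < c\<close> by (simp add: mult.assoc[symmetric] mult.commute[of "cnj a"])
      then have "basic_at \<zeta> (a *\<^sub>C y)"
        using \<zeta> by (simp add: basic_at_def ip_scaleC_left ip_scaleC_right ip_y scaleC_scaleC
            scaleC_one)
      then have "Re (vform \<zeta> (R (a *\<^sub>C y)) (R (a *\<^sub>C y))) \<le> M"
        by (rule basic_le)
      moreover have "vform \<zeta> (R (a *\<^sub>C y)) (R (a *\<^sub>C y)) = complex_of_real (1 / c) * vform \<zeta> (R u) (R u)"
        unfolding a[symmetric] R_y[symmetric]
        by (simp add: adjointable_linear[OF R] vform.scaleC_left vform.scaleC_right mult.assoc)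
      ultimately show ?thesis
        using \<open>0 < c\<close> by (simp add: field_simps c_def del: of_real_divide)
    qed
  qed
  show False
  proof (cases "0 \<le> M")
    case True
    have "norm (R u) \<le> sqrt M * norm u" for u
    proof (rule power2_le_imp_le)
      have "(norm (R u))\<^sup>2 \<le> M * (norm u)\<^sup>2"
      proof (rule norm_le_if_vform_le)
        fix \<zeta> :: 'h assume \<zeta>: "norm \<zeta> = 1"
        have "M * Re (vform \<zeta> u u) \<le> M * (norm u)\<^sup>2"
          using vform_self_le[of \<zeta> u] \<zeta> True by (intro mult_left_mono) auto
        with form_le[OF \<zeta>] show "Re (vform \<zeta> (R u) (R u)) \<le> M * (norm u)\<^sup>2"
          by (rule order_trans)
      qed (simp add: True)
      then show "(norm (R u))\<^sup>2 \<le> (sqrt M * norm u)\<^sup>2"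
        using True by (simp add: power_mult_distrib)
    qed (simp add: True)
    then have "onorm R \<le> sqrt M"
      by (intro onorm_bound) (simp_all add: True)
    then have "(onorm R)\<^sup>2 \<le> (sqrt M)\<^sup>2"
      by (intro power_mono onorm_pos_le adjointable_bounded_linear[OF R])
    then show False
      using M True by simp
  next
    case False
    have "(norm u)\<^sup>2 \<le> 0" for u :: 'e
    proof (rule norm_le_if_vform_le)
      fix \<zeta> :: 'h assume "norm \<zeta> = 1"
      then have "0 \<le> M * Re (vform \<zeta> u u)"
        using form_le[of \<zeta> u] vform.nonneg[of \<zeta> "R u"] by linarith
      then show "Re (vform \<zeta> u u) \<le> 0"
        using False by (simp add: zero_le_mult_iff)
    qed simp
    then show False
      using nonzero by simp
  qed
qed

section \<open>Norm-parallelism and the cross term\<close>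

text \<open>A point of the disc of radius \<open>m\<close> whose real part is close to \<open>m\<close> is close to \<open>m\<close>:
  \<open>\<bar>z - m\<bar>\<^sup>2 \<le> 2 m (m - Re z)\<close>.\<close>

lemma tendsto_if_Re_tendsto_max:
  fixes z :: "nat \<Rightarrow> complex" and m :: real
  assumes cmod_le: "\<And>n. cmod (z n) \<le> m" and Re: "(\<lambda>n. Re (z n)) \<longlonglongrightarrow> m"
  shows "z \<longlonglongrightarrow> complex_of_real m"
proof -
  have "(cmod (z n - complex_of_real m))\<^sup>2 \<le> 2 * m * (m - Re (z n))" for n
  proof -
    have "0 \<le> m"
      using cmod_le[of n] norm_ge_zero order_trans by blast
    then have "(cmod (z n))\<^sup>2 \<le> m\<^sup>2"
      using cmod_le[of n] by (intro power_mono) auto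
    then show ?thesis
      unfolding cmod_power2 by (simp add: power2_eq_square algebra_simps)
  qed
  then have bound: "\<forall>n. norm ((cmod (z n - complex_of_real m))\<^sup>2) \<le> 2 * m * (m - Re (z n))"
    by simp
  have "(\<lambda>n. 2 * m * (m - Re (z n))) \<longlonglongrightarrow> 2 * m * (m - m)"
    by (intro tendsto_intros Re)
  then have "(\<lambda>n. 2 * m * (m - Re (z n))) \<longlonglongrightarrow> 0"
    by simp
  with always_eventually[OF bound] have "(\<lambda>n. (cmod (z n - complex_of_real m))\<^sup>2) \<longlonglongrightarrow> 0"
    by (rule Lim_null_comparison)
  then have "(\<lambda>n. sqrt ((cmod (z n - complex_of_real m))\<^sup>2)) \<longlonglongrightarrow> sqrt 0"
    by (rule tendsto_real_sqrt)
  then have "(\<lambda>n. z n - complex_of_real m) \<longlonglongrightarrow> 0"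
    by (simp add: tendsto_norm_zero_iff)
  then show ?thesis
    by (rule LIM_zero_cancel)
qed

lemma vform_add_unimodular:
  assumes "cmod \<alpha> = 1"
  shows "Re (vform \<zeta> (a + \<alpha> *\<^sub>C b) (a + \<alpha> *\<^sub>C b)) =
    Re (vform \<zeta> a a) + Re (vform \<zeta> b b) + 2 * Re (cnj \<alpha> * vform \<zeta> a b)"
  using vform.Re_self_add_scaleC[of \<zeta> a \<alpha> b] assms by simp

lemma cmod_vform_basic_le:
  assumes "adjointable ip T" "adjointable ip S" "basic_at \<zeta> x"
  shows "cmod (vform \<zeta> (T x) (S x)) \<le> onorm T * onorm S"
proof (rule power2_le_imp_le)
  show "(cmod (vform \<zeta> (T x) (S x)))\<^sup>2 \<le> (onorm T * onorm S)\<^sup>2"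
    unfolding power_mult_distrib using assms
    by (intro order_trans[OF vform.cauchy_schwarz] mult_mono vform_basic_le vform.nonneg) auto
qed (intro mult_nonneg_nonneg onorm_pos_le adjointable_bounded_linear assms)

text \<open>At basic vectors almost attaining \<open>\<parallel>T + \<alpha>S\<parallel>\<^sup>2 = (\<parallel>T\<parallel> + \<parallel>S\<parallel>)\<^sup>2\<close> the two diagonal terms take up at
  most \<open>\<parallel>T\<parallel>\<^sup>2 + \<parallel>S\<parallel>\<^sup>2\<close>, so the cross term has to be almost \<open>2 \<parallel>T\<parallel> \<parallel>S\<parallel>\<close>.\<close>

lemma basic_sequence_if_parallel:
  assumes T: "adjointable ip T" and S: "adjointable ip S" and nonzero: "\<exists>x::'e. x \<noteq> 0"
    and \<alpha>: "cmod \<alpha> = 1" and onorm_eq: "onorm (\<lambda>x. T x + \<alpha> *\<^sub>C S x) = onorm T + onorm S"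
  obtains \<xi> x where "\<forall>n::nat. basic_at (\<xi> n) (x n)"
    and "(\<lambda>n. vform (\<xi> n) (T (x n)) (S (x n))) \<longlonglongrightarrow> \<alpha> * complex_of_real (onorm T * onorm S)"
proof -
  let ?R = "\<lambda>x. T x + \<alpha> *\<^sub>C S x" and ?m = "onorm T * onorm S"
  have "\<exists>\<zeta> x. basic_at \<zeta> x \<and>
      (onorm ?R)\<^sup>2 - inverse (real (Suc n)) < Re (vform \<zeta> (?R x) (?R x))" for n
  proof -
    have "(onorm ?R)\<^sup>2 - inverse (real (Suc n)) < (onorm ?R)\<^sup>2"
      by simp
    from obtain_basic_near_onorm[OF adjointable_add_scaleC[OF T S, of \<alpha>] nonzero this]
    obtain \<zeta> x where "basic_at \<zeta> x"
      and "(onorm ?R)\<^sup>2 - inverse (real (Suc n)) < Re (vform \<zeta> (?R x) (?R x))" .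
    then show ?thesis
      by (intro exI conjI)
  qed
  then obtain \<xi> where "\<forall>n. \<exists>x. basic_at (\<xi> n) x \<and>
      (onorm ?R)\<^sup>2 - inverse (real (Suc n)) < Re (vform (\<xi> n) (?R x) (?R x))"
    using choice[of "\<lambda>n \<zeta>. \<exists>x. basic_at \<zeta> x \<and>
      (onorm ?R)\<^sup>2 - inverse (real (Suc n)) < Re (vform \<zeta> (?R x) (?R x))"] by blast
  from choice[OF this] obtain x where
    "\<forall>n. basic_at (\<xi> n) (x n) \<and>
      (onorm ?R)\<^sup>2 - inverse (real (Suc n)) < Re (vform (\<xi> n) (?R (x n)) (?R (x n)))" ..
  then have basic: "basic_at (\<xi> n) (x n)"
    and near: "(onorm ?R)\<^sup>2 - inverse (real (Suc n)) < Re (vform (\<xi> n) (?R (x n)) (?R (x n)))" for n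
    by blast+
  define z where "z n = cnj \<alpha> * vform (\<xi> n) (T (x n)) (S (x n))" for n
  have cmod_z: "cmod (z n) \<le> ?m" for n
    using cmod_vform_basic_le[OF T S basic] \<alpha> by (simp add: z_def norm_mult)
  have "(\<lambda>n. Re (z n)) \<longlonglongrightarrow> ?m"
  proof (rule tendsto_sandwich[OF always_eventually always_eventually])
    show "\<forall>n. ?m - inverse (real (Suc n)) / 2 \<le> Re (z n)"
    proof
      fix n
      show "?m - inverse (real (Suc n)) / 2 \<le> Re (z n)"
        using near[of n] vform_basic_le[OF T basic[of n]] vform_basic_le[OF S basic[of n]]
        unfolding onorm_eq vform_add_unimodular[OF \<alpha>] z_def[symmetric]
        by (simp add: power2_sum)
    qed
    show "\<forall>n. Re (z n) \<le> ?m"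
      using complex_Re_le_cmod cmod_z by (meson order_trans)
    have "(\<lambda>n. ?m - inverse (real (Suc n)) / 2) \<longlonglongrightarrow> ?m - 0 / 2"
      by (intro tendsto_intros LIMSEQ_inverse_real_of_nat) simp
    then show "(\<lambda>n. ?m - inverse (real (Suc n)) / 2) \<longlonglongrightarrow> ?m"
      by simp
  qed simp
  then have "z \<longlonglongrightarrow> complex_of_real ?m"
    by (rule tendsto_if_Re_tendsto_max[OF cmod_z])
  then have "(\<lambda>n. \<alpha> * z n) \<longlonglongrightarrow> \<alpha> * complex_of_real ?m"
    by (rule tendsto_mult_left)
  moreover have "\<alpha> * z n = vform (\<xi> n) (T (x n)) (S (x n))" for n
    using \<alpha> complex_norm_square[of \<alpha>] by (simp add: z_def mult.assoc[symmetric])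
  ultimately have "(\<lambda>n. vform (\<xi> n) (T (x n)) (S (x n))) \<longlonglongrightarrow> \<alpha> * complex_of_real ?m"
    by (simp only:)
  moreover have "\<forall>n. basic_at (\<xi> n) (x n)"
    using basic by blast
  ultimately show thesis
    by (intro that)
qed

text \<open>If neither norm vanishes, Cauchy-Schwarz bounds the diagonal terms from below by the square of the
  cross term divided by \<open>\<parallel>S\<parallel>\<^sup>2\<close> and \<open>\<parallel>T\<parallel>\<^sup>2\<close>, so they tend to \<open>\<parallel>T\<parallel>\<^sup>2\<close> and \<open>\<parallel>S\<parallel>\<^sup>2\<close>. If one norm vanishes,
  that map is zero and the norms add up trivially.\<close>

lemma parallel_if_basic_sequence:
  assumes T: "adjointable ip T" and S: "adjointable ip S" and \<alpha>: "cmod \<alpha> = 1"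
    and basic: "\<And>n::nat. basic_at (\<xi> n) (x n)"
    and lim: "(\<lambda>n. vform (\<xi> n) (T (x n)) (S (x n))) \<longlonglongrightarrow> \<alpha> * complex_of_real (onorm T * onorm S)"
  shows "onorm (\<lambda>x. T x + \<alpha> *\<^sub>C S x) = onorm T + onorm S"
proof -
  let ?R = "\<lambda>x. T x + \<alpha> *\<^sub>C S x"
  define a b where "a = onorm T" and "b = onorm S"
  have R: "adjointable ip ?R"
    by (rule adjointable_add_scaleC[OF T S])
  have bounded: "bounded_linear T" "bounded_linear S" "bounded_linear ?R"
    by (intro adjointable_bounded_linear T S R)+
  have onorm_\<alpha>S: "onorm (\<lambda>x. \<alpha> *\<^sub>C S x) = onorm S"
    by (simp add: onorm_def norm_scaleC \<alpha>)
  have ab: "0 \<le> a" "0 \<le> b"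
    using bounded by (simp_all add: a_def b_def onorm_pos_le)
  consider "a = 0" | "b = 0" | "0 < a" "0 < b"
    using ab by linarith
  then show ?thesis
  proof cases
    case 1
    then show ?thesis
      using onorm_eq_0[OF bounded(1)] onorm_\<alpha>S by (simp add: a_def)
  next
    case 2
    then show ?thesis
      using onorm_eq_0[OF bounded(2)] by (simp add: b_def scaleC_zero_right)
  next
    case 3
    define z where "z n = cnj \<alpha> * vform (\<xi> n) (T (x n)) (S (x n))" for n
    have "cnj \<alpha> * \<alpha> = 1"
      using \<alpha> complex_norm_square[of \<alpha>] by (simp add: mult.commute)
    then have z_lim: "z \<longlonglongrightarrow> complex_of_real (a * b)"
      using tendsto_mult_left[OF lim, of "cnj \<alpha>"]
      unfolding z_def a_def b_def by (simp add: mult.assoc[symmetric])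
    have "(cmod (z n))\<^sup>2 / b\<^sup>2 + (cmod (z n))\<^sup>2 / a\<^sup>2 + 2 * Re (z n) \<le> (onorm ?R)\<^sup>2" for n
    proof -
      define p s where "p = Re (vform (\<xi> n) (T (x n)) (T (x n)))"
        and "s = Re (vform (\<xi> n) (S (x n)) (S (x n)))"
      have cs: "(cmod (z n))\<^sup>2 \<le> p * s"
        unfolding z_def norm_mult p_def s_def using vform.cauchy_schwarz \<alpha> by simp
      have nonneg: "0 \<le> p" "0 \<le> s"
        by (simp_all add: p_def s_def vform.nonneg)
      have le: "p \<le> a\<^sup>2" "s \<le> b\<^sup>2"
        unfolding p_def s_def a_def b_def by (intro vform_basic_le T S basic)+
      have "(cmod (z n))\<^sup>2 \<le> p * b\<^sup>2" "(cmod (z n))\<^sup>2 \<le> a\<^sup>2 * s"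
        using cs mult_left_mono[OF le(2) nonneg(1)] mult_right_mono[OF le(1) nonneg(2)] by linarith+
      then have "(cmod (z n))\<^sup>2 / b\<^sup>2 \<le> p" "(cmod (z n))\<^sup>2 / a\<^sup>2 \<le> s"
        using 3 by (simp_all add: divide_le_eq mult.commute)
      moreover have "p + s + 2 * Re (z n) \<le> (onorm ?R)\<^sup>2"
        using vform_basic_le[OF R basic[of n]]
        unfolding vform_add_unimodular[OF \<alpha>] p_def s_def z_def .
      ultimately show ?thesis
        by linarith
    qed
    moreover have "(\<lambda>n. (cmod (z n))\<^sup>2 / b\<^sup>2 + (cmod (z n))\<^sup>2 / a\<^sup>2 + 2 * Re (z n)) \<longlonglongrightarrow>
        (cmod (complex_of_real (a * b)))\<^sup>2 / b\<^sup>2 + (cmod (complex_of_real (a * b)))\<^sup>2 / a\<^sup>2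
          + 2 * Re (complex_of_real (a * b))"
      by (intro tendsto_intros z_lim) (use 3 in auto)
    ultimately have "(cmod (complex_of_real (a * b)))\<^sup>2 / b\<^sup>2 + (cmod (complex_of_real (a * b)))\<^sup>2 / a\<^sup>2
        + 2 * Re (complex_of_real (a * b)) \<le> (onorm ?R)\<^sup>2"
      by (intro LIMSEQ_le_const2) auto
    then have "(a + b)\<^sup>2 \<le> (onorm ?R)\<^sup>2"
      using 3 by (simp add: norm_mult power_mult_distrib power2_sum)
    then have "a + b \<le> onorm ?R"
      by (rule power2_le_imp_le) (rule onorm_pos_le[OF bounded(3)])
    moreover have "onorm ?R \<le> a + b"
      using onorm_triangle[OF bounded(1) bounded_linear_compose[OF bounded_linear_scaleC bounded(2)], of \<alpha>]
      by (simp add: onorm_\<alpha>S a_def b_def)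
    ultimately show ?thesis
      by (simp add: a_def b_def)
  qed
qed

end

theorem theorem3p2:
  fixes act :: "('h::complex_hilbert \<Rightarrow> 'h) \<Rightarrow> 'e::complex_banach \<Rightarrow> 'e"
    and ip :: "'e \<Rightarrow> 'e \<Rightarrow> 'h \<Rightarrow> 'h"
    and T S :: "'e \<Rightarrow> 'e"
  assumes "hilbert_compacts_module act ip"
    and "\<exists>x::'e. x \<noteq> 0"
    and "adjointable ip T" and "adjointable ip S"
  shows "T \<parallel>\<^sub>o\<^sub>p S \<longleftrightarrow>
    (\<exists>(x :: nat \<Rightarrow> 'e) (\<xi> :: nat \<Rightarrow> 'h) (\<alpha> :: complex).
      (\<forall>n. basic_vector ip (x n) \<and> norm (\<xi> n) = 1 \<and> ip (x n) (x n) = \<xi> n \<otimes>\<^sub>H \<xi> n) \<and>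
      cmod \<alpha> = 1 \<and>
      (\<lambda>n. cinner (ip (T (x n)) (S (x n)) (\<xi> n)) (\<xi> n))
        \<longlonglongrightarrow> \<alpha> * complex_of_real (onorm T) * complex_of_real (onorm S))"
proof -
  interpret hilbert_compacts_module act ip
    by fact
  have basic_iff: "basic_vector ip y \<and> norm \<zeta> = 1 \<and> ip y y = \<zeta> \<otimes>\<^sub>H \<zeta> \<longleftrightarrow> basic_at \<zeta> y" for y \<zeta>
    using basic_at_basic_vector by (auto simp: basic_at_def)
  have limit_eq: "\<alpha> * complex_of_real (onorm T) * complex_of_real (onorm S) =
      \<alpha> * complex_of_real (onorm T * onorm S)" for \<alpha>
    by simp
  show ?thesis
    unfolding basic_iff limit_eq vform_def[symmetric] op_parallel_def
  proof
    assume "\<exists>\<alpha>. cmod \<alpha> = 1 \<and> onorm (\<lambda>x. T x + \<alpha> *\<^sub>C S x) = onorm T + onorm S"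
    then obtain \<alpha> where \<alpha>: "cmod \<alpha> = 1" "onorm (\<lambda>x. T x + \<alpha> *\<^sub>C S x) = onorm T + onorm S"
      by blast
    from basic_sequence_if_parallel[OF assms(3,4,2) \<alpha>]
    obtain \<xi> x where "\<forall>n. basic_at (\<xi> n) (x n)"
      and "(\<lambda>n. vform (\<xi> n) (T (x n)) (S (x n))) \<longlonglongrightarrow> \<alpha> * complex_of_real (onorm T * onorm S)" .
    with \<alpha>(1) show "\<exists>x \<xi> \<alpha>. (\<forall>n. basic_at (\<xi> n) (x n)) \<and> cmod \<alpha> = 1 \<and>
        (\<lambda>n. vform (\<xi> n) (T (x n)) (S (x n))) \<longlonglongrightarrow> \<alpha> * complex_of_real (onorm T * onorm S)"
      by (intro exI conjI)
  next
    assume "\<exists>x \<xi> \<alpha>. (\<forall>n. basic_at (\<xi> n) (x n)) \<and> cmod \<alpha> = 1 \<and>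
        (\<lambda>n. vform (\<xi> n) (T (x n)) (S (x n))) \<longlonglongrightarrow> \<alpha> * complex_of_real (onorm T * onorm S)"
    then obtain x \<xi> \<alpha> where basic: "\<And>n. basic_at (\<xi> n) (x n)" and \<alpha>: "cmod \<alpha> = 1"
      and lim: "(\<lambda>n. vform (\<xi> n) (T (x n)) (S (x n))) \<longlonglongrightarrow> \<alpha> * complex_of_real (onorm T * onorm S)"
      by blast
    have "onorm (\<lambda>x. T x + \<alpha> *\<^sub>C S x) = onorm T + onorm S"
      by (rule parallel_if_basic_sequence[OF assms(3,4) \<alpha> basic lim])
    with \<alpha> show "\<exists>\<alpha>. cmod \<alpha> = 1 \<and> onorm (\<lambda>x. T x + \<alpha> *\<^sub>C S x) = onorm T + onorm S"
      by blast
  qed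
qed

end
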